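(* For every $a\in\mathbb{N}^*$, the fragment $\mathcal{H}^c_{a,\infty}$ is reducible to $\mathcal{H}^c_{a,2}$.
   Context: Clauses and fragments. - Clauses are function-free second-order Horn clauses: a head (at most one positive literal) and a finite body of negative literals. Each literal is a predicate variable of arity in $\mathbb{N}^*$ applied to term variables. - The body size $|C|$ is the number of body literals. - A clause is connected if its literals cannot be partitioned into two non-empty sets with disjoint sets of variables. $\mathcal{H}^c$ is the set of connected clauses. - $\mathcal{F}_{a,b}$ denotes the clauses of $\mathcal{F}$ with all literal arities at most $a$ and body size at most $b$; $\infty$ means no bound. - Fragments are considered modulo variable renaming and contain only the most general clauses up to variable unification: for each clause $C$ satisfying the syntactic restrictions there is a clause $C_{\mathcal{F}}$ in the fragment with $C_{\mathcal{F}}\sigma=C$ for some substitution $\sigma$. Accordingly, inferences are taken modulo variable unification. SLD-resolution. - Substitutions map term variables to term variables and predicate variables to predicate variables of the same arity. - An SLD-resolution inference $C_1,C_2\vdash C$ is binary resolution without factoring: a body literal of one premise is unified by a most general unifier with the head of the other, and the resolvent consists of the remaining literals with the unifier applied. Reducibility. A fragment $\mathcal{F}$ is reducible to $\mathcal{F}_{\infty,b}$ if, for every $C\in\mathcal{F}$ with $b<|C|$, there exists $b'<|C|$ such that $C$ is the resolvent of an SLD-inference whose premises lie in $\mathcal{F}_{\infty,b'}$. Here $(\mathcal{H}^c_{a,\infty})_{\infty,b'}=\mathcal{H}^c_{a,b'}$. *)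

theory Defs
  imports Main "HOL-Library.Multiset" "HOL-Library.Extended_Nat"
begin

type_synonym tvar = nat

datatype pvar = PVar (pname: nat) (arity: nat)

datatype atom = Atom (pred_of: pvar) (args_of: "tvar list")

text \<open>A Horn clause. The body is a multiset because resolution does not factor literals and
  the body size counts literals with multiplicity. The literals are kept as atoms: the position
  (head or body) determines the sign.\<close>

datatype clause = Clause (head: "atom option") (body: "atom multiset")

definition wf_atom :: "atom \<Rightarrow> bool" where
  "wf_atom A \<longleftrightarrow> 1 \<le> arity (pred_of A) \<and> length (args_of A) = arity (pred_of A)"

definition lits :: "clause \<Rightarrow> atom multiset" where
  "lits C = (case head C of None \<Rightarrow> {#} | Some H \<Rightarrow> {#H#}) + body C"

definition wf_clause :: "clause \<Rightarrow> bool" where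
  "wf_clause C \<longleftrightarrow> (\<forall>A \<in># lits C. wf_atom A)"

definition body_size :: "clause \<Rightarrow> nat" where
  "body_size C = size (body C)"

definition tvars_lits :: "atom multiset \<Rightarrow> tvar set" where
  "tvars_lits M = (\<Union>A \<in> set_mset M. set (args_of A))"

definition pvars_lits :: "atom multiset \<Rightarrow> pvar set" where
  "pvars_lits M = pred_of ` set_mset M"

text \<open>Only shared term variables connect literals; a shared predicate variable does not.\<close>

definition connected_clause :: "clause \<Rightarrow> bool" where
  "connected_clause C \<longleftrightarrow>
     \<not> (\<exists>M N. M \<noteq> {#} \<and> N \<noteq> {#} \<and> lits C = M + N \<and> tvars_lits M \<inter> tvars_lits N = {})"

type_synonym subst = "(pvar \<Rightarrow> pvar) \<times> (tvar \<Rightarrow> tvar)"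

definition is_subst :: "subst \<Rightarrow> bool" where
  "is_subst \<sigma> \<longleftrightarrow> (\<forall>p. arity (fst \<sigma> p) = arity p)"

definition is_renaming :: "subst \<Rightarrow> bool" where
  "is_renaming \<sigma> \<longleftrightarrow> is_subst \<sigma> \<and> bij (fst \<sigma>) \<and> bij (snd \<sigma>)"

definition comp_subst :: "subst \<Rightarrow> subst \<Rightarrow> subst" where
  "comp_subst \<delta> \<sigma> = (fst \<delta> \<circ> fst \<sigma>, snd \<delta> \<circ> snd \<sigma>)"

definition subst_atom :: "subst \<Rightarrow> atom \<Rightarrow> atom" where
  "subst_atom \<sigma> A = Atom (fst \<sigma> (pred_of A)) (map (snd \<sigma>) (args_of A))"

definition subst_clause :: "subst \<Rightarrow> clause \<Rightarrow> clause" where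
  "subst_clause \<sigma> C =
     Clause (map_option (subst_atom \<sigma>) (head C)) (image_mset (subst_atom \<sigma>) (body C))"

definition variant :: "clause \<Rightarrow> clause \<Rightarrow> bool" where
  "variant C D \<longleftrightarrow> (\<exists>\<rho>. is_renaming \<rho> \<and> subst_clause \<rho> C = D)"

definition bounded_clauses :: "clause set \<Rightarrow> enat \<Rightarrow> enat \<Rightarrow> clause set" where
  "bounded_clauses F a b =
     {C \<in> F. (\<forall>A \<in># lits C. enat (arity (pred_of A)) \<le> a) \<and> enat (body_size C) \<le> b}"

text \<open>The clauses of \<open>S\<close> that are not a proper instance of another clause of \<open>S\<close>. Working modulo
  variable renaming is rendered by keeping all variants instead of choosing representatives.\<close>

definition most_general :: "clause set \<Rightarrow> clause set" where
  "most_general S =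
     {C \<in> S. \<forall>D \<in> S. \<forall>\<sigma>. is_subst \<sigma> \<and> subst_clause \<sigma> D = C \<longrightarrow> variant C D}"

definition Hc :: "enat \<Rightarrow> enat \<Rightarrow> clause set" where
  "Hc a b = most_general (bounded_clauses {C. wf_clause C \<and> connected_clause C} a b)"

definition is_unifier :: "subst \<Rightarrow> atom \<Rightarrow> atom \<Rightarrow> bool" where
  "is_unifier \<theta> A B \<longleftrightarrow> is_subst \<theta> \<and> subst_atom \<theta> A = subst_atom \<theta> B"

definition is_mgu :: "subst \<Rightarrow> atom \<Rightarrow> atom \<Rightarrow> bool" where
  "is_mgu \<theta> A B \<longleftrightarrow> is_unifier \<theta> A B \<and>
     (\<forall>\<tau>. is_unifier \<tau> A B \<longrightarrow> (\<exists>\<delta>. is_subst \<delta> \<and> \<tau> = comp_subst \<delta> \<theta>))"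

definition variable_disjoint :: "clause \<Rightarrow> clause \<Rightarrow> bool" where
  "variable_disjoint C D \<longleftrightarrow>
     tvars_lits (lits C) \<inter> tvars_lits (lits D) = {} \<and>
     pvars_lits (lits C) \<inter> pvars_lits (lits D) = {}"

definition resolve_body_head :: "clause \<Rightarrow> clause \<Rightarrow> clause \<Rightarrow> bool" where
  "resolve_body_head C D R \<longleftrightarrow> (\<exists>L H \<theta>. L \<in># body C \<and> head D = Some H \<and> is_mgu \<theta> L H \<and>
     R = subst_clause \<theta> (Clause (head C) ((body C - {#L#}) + body D)))"

definition sld_resolvent :: "clause \<Rightarrow> clause \<Rightarrow> clause \<Rightarrow> bool" where
  "sld_resolvent C D R \<longleftrightarrow> variable_disjoint C D \<and>
     (resolve_body_head C D R \<or> resolve_body_head D C R)"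

text \<open>SLD-inference modulo variable renaming and variable unification: since a fragment contains
  only most general clauses, its members stand for their instances, so variables of the premises
  may be unified (or renamed, in particular to make the premises variable-disjoint) before
  resolving. The resolvent has to be the conclusion itself, up to renaming.\<close>

definition sld_inference :: "clause \<Rightarrow> clause \<Rightarrow> clause \<Rightarrow> bool" where
  "sld_inference C\<^sub>1 C\<^sub>2 C \<longleftrightarrow> (\<exists>\<sigma>\<^sub>1 \<sigma>\<^sub>2 R. is_subst \<sigma>\<^sub>1 \<and> is_subst \<sigma>\<^sub>2 \<and>
     sld_resolvent (subst_clause \<sigma>\<^sub>1 C\<^sub>1) (subst_clause \<sigma>\<^sub>2 C\<^sub>2) R \<and> variant R C)"

text \<open>The target of the reduction is \<open>bounded_clauses F \<infinity> b\<close>; for \<open>F = Hc a \<infinity>\<close> it equals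
  \<open>Hc a b\<close> by \<open>bounded_Hc\<close> below.\<close>

definition reducible_to :: "clause set \<Rightarrow> nat \<Rightarrow> bool" where
  "reducible_to F b \<longleftrightarrow> (\<forall>C \<in> F. b < body_size C \<longrightarrow>
     (\<exists>b' < body_size C. \<exists>C\<^sub>1 \<in> bounded_clauses F \<infinity> (enat b'). \<exists>C\<^sub>2 \<in> bounded_clauses F \<infinity> (enat b').
        sld_inference C\<^sub>1 C\<^sub>2 C))"

lemma lits_subst: "lits (subst_clause \<sigma> C) = image_mset (subst_atom \<sigma>) (lits C)"
  by (cases C) (auto simp: lits_def subst_clause_def split: option.splits)

lemma body_size_subst [simp]: "body_size (subst_clause \<sigma> C) = body_size C"
  by (simp add: body_size_def subst_clause_def)

lemma bounded_Hc: "bounded_clauses (Hc a \<infinity>) \<infinity> b = Hc a b"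
proof (intro equalityI subsetI)
  fix C assume "C \<in> bounded_clauses (Hc a \<infinity>) \<infinity> b"
  then show "C \<in> Hc a b"
    by (auto simp: Hc_def most_general_def bounded_clauses_def)
next
  fix C assume C: "C \<in> Hc a b"
  have "enat (body_size D) \<le> b" if "subst_clause \<sigma> D = C" for \<sigma> D
    using C that by (auto simp: Hc_def most_general_def bounded_clauses_def)
  then show "C \<in> bounded_clauses (Hc a \<infinity>) \<infinity> b"
    using C unfolding Hc_def most_general_def bounded_clauses_def by simp blast
qed

lemma bij_extend_nat:
  fixes f :: "nat \<Rightarrow> nat"
  assumes "finite A" "inj_on f A"
  shows "\<exists>g. bij g \<and> (\<forall>x\<in>A. g x = f x)"
proof -
  let ?U = "A \<union> f ` A"
  have "card (?U - A) = card (?U - f ` A)"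
    using assms by (simp add: card_Diff_subset card_image)
  then obtain h where h: "bij_betw h (?U - A) (?U - f ` A)"
    using assms(1) by (meson finite_Diff finite_UnI finite_imageI finite_same_card_bij)
  have f: "bij_betw f A (f ` A)" using assms(2) by (simp add: bij_betw_def)
  have i: "bij_betw id (- ?U) (- ?U)" by simp
  define g where "g x = (if x \<in> A then f x else if x \<in> ?U then h x else x)" for x
  have gA: "bij_betw g A (f ` A)" using f by (rule bij_betw_cong[THEN iffD1, rotated]) (simp add: g_def)
  have gU: "bij_betw g (?U - A) (?U - f ` A)"
    using h by (rule bij_betw_cong[THEN iffD1, rotated]) (auto simp: g_def)
  have gR: "bij_betw g (- ?U) (- ?U)"
    using i by (rule bij_betw_cong[THEN iffD1, rotated]) (auto simp: g_def)
  have 1: "bij_betw g (A \<union> (?U - A)) (f ` A \<union> (?U - f ` A))"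
    using gA gU by (rule bij_betw_combine) auto
  have "bij_betw g ((A \<union> (?U - A)) \<union> - ?U) ((f ` A \<union> (?U - f ` A)) \<union> - ?U)"
    using 1 gR by (rule bij_betw_combine) auto
  moreover have "(A \<union> (?U - A)) \<union> - ?U = UNIV" "(f ` A \<union> (?U - f ` A)) \<union> - ?U = UNIV" by auto
  ultimately have "bij g" by simp
  then show ?thesis by (auto simp: g_def)
qed

lemma bij_extend_pvar:
  assumes fin: "finite A" and inj: "inj_on f A" and ar: "\<forall>p. arity (f p) = arity p"
  shows "\<exists>g. bij g \<and> (\<forall>p. arity (g p) = arity p) \<and> (\<forall>p\<in>A. g p = f p)"
proof -
  have "\<exists>g. bij g \<and> (\<forall>x\<in>{x. PVar x n \<in> A}. g x = pname (f (PVar x n)))" for n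
  proof (rule bij_extend_nat)
    have "{x. PVar x n \<in> A} \<subseteq> pname ` A" by force
    then show "finite {x. PVar x n \<in> A}" using fin finite_surj by blast
    show "inj_on (\<lambda>x. pname (f (PVar x n))) {x. PVar x n \<in> A}"
    proof (rule inj_onI, simp)
      fix x y assume "PVar x n \<in> A" "PVar y n \<in> A" "pname (f (PVar x n)) = pname (f (PVar y n))"
      moreover from this ar have "f (PVar x n) = f (PVar y n)"
        by (metis pvar.exhaust_sel pvar.sel(2))
      ultimately show "x = y" using inj by (metis inj_onD pvar.inject)
    qed
  qed
  then obtain G where G: "\<And>n. bij (G n)"
    "\<And>n x. PVar x n \<in> A \<Longrightarrow> G n x = pname (f (PVar x n))" by (metis mem_Collect_eq)
  define g where "g p = PVar (G (arity p) (pname p)) (arity p)" for p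
  have "bij g"
  proof (rule bijI)
    show "inj g"
    proof (rule injI)
      fix p q assume "g p = g q"
      then show "p = q" using G(1) unfolding g_def
        by (metis bij_def inj_eq pvar.exhaust_sel pvar.inject)
    qed
    show "surj g"
    proof (rule surjI)
      fix q show "g (PVar (inv (G (arity q)) (pname q)) (arity q)) = q"
        using G(1) by (simp add: g_def bij_is_surj surj_f_inv_f)
    qed
  qed
  moreover have "g p = f p" if "p \<in> A" for p
    using G(2)[of "pname p" "arity p"] that ar by (simp add: g_def pvar.expand)
  ultimately show ?thesis by (auto simp: g_def)
qed

definition nvars :: "clause \<Rightarrow> nat" where
  "nvars C = card (tvars_lits (lits C)) + card (pvars_lits (lits C))"

lemma tvars_subst: "tvars_lits (lits (subst_clause \<sigma> C)) = snd \<sigma> ` tvars_lits (lits C)"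
  by (auto simp: lits_subst tvars_lits_def subst_atom_def)

lemma pvars_subst: "pvars_lits (lits (subst_clause \<sigma> C)) = fst \<sigma> ` pvars_lits (lits C)"
  by (auto simp: lits_subst pvars_lits_def subst_atom_def image_iff)

lemma finite_vars: "finite (tvars_lits (lits C))" "finite (pvars_lits (lits C))"
  by (auto simp: tvars_lits_def pvars_lits_def)

lemma subst_clause_cong:
  assumes "\<And>x. x \<in> tvars_lits (lits C) \<Longrightarrow> snd \<sigma> x = snd \<tau> x"
    and "\<And>p. p \<in> pvars_lits (lits C) \<Longrightarrow> fst \<sigma> p = fst \<tau> p"
  shows "subst_clause \<sigma> C = subst_clause \<tau> C"
proof -
  have "subst_atom \<sigma> A = subst_atom \<tau> A" if "A \<in># lits C" for A
    using assms that by (auto simp: subst_atom_def tvars_lits_def pvars_lits_def)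
  then show ?thesis
    by (cases C; cases "head C") (auto simp: subst_clause_def lits_def intro!: image_mset_cong)
qed

lemma subst_id: "subst_clause (id, id) C = C"
proof -
  have "subst_atom (id, id) = id" by (auto simp: subst_atom_def)
  then show ?thesis by (cases C) (simp add: subst_clause_def option.map_id)
qed

lemma subst_comp: "subst_clause \<delta> (subst_clause \<sigma> C) = subst_clause (comp_subst \<delta> \<sigma>) C"
proof -
  have "subst_atom \<delta> \<circ> subst_atom \<sigma> = subst_atom (comp_subst \<delta> \<sigma>)"
    by (auto simp: subst_atom_def comp_subst_def)
  then show ?thesis
    by (cases C) (simp add: subst_clause_def option.map_comp multiset.map_comp)
qed

lemma variant_sym: "variant C D \<Longrightarrow> variant D C"
proof -
  assume "variant C D"
  then obtain \<rho> where r: "is_renaming \<rho>" "subst_clause \<rho> C = D" by (auto simp: variant_def)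
  let ?i = "(inv (fst \<rho>), inv (snd \<rho>))"
  have "arity (inv (fst \<rho>) p) = arity p" for p
    using r(1) unfolding is_renaming_def is_subst_def by (metis bij_inv_eq_iff)
  then have "is_renaming ?i"
    using r(1) by (auto simp: is_renaming_def is_subst_def bij_imp_bij_inv)
  moreover have "comp_subst ?i \<rho> = (id, id)"
    using r(1) by (simp add: comp_subst_def is_renaming_def bij_is_inj)
  then have "subst_clause ?i D = C" using r(2) subst_comp subst_id by metis
  ultimately show ?thesis unfolding variant_def by blast
qed

lemma nvars_less:
  assumes "is_subst \<sigma>" "subst_clause \<sigma> D = C" "\<not> variant C D"
  shows "nvars C < nvars D"
proof (rule ccontr)
  assume "\<not> nvars C < nvars D"
  moreover have "card (tvars_lits (lits C)) \<le> card (tvars_lits (lits D))"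
    "card (pvars_lits (lits C)) \<le> card (pvars_lits (lits D))"
    using assms(2) finite_vars[of D] tvars_subst[of \<sigma> D] pvars_subst[of \<sigma> D]
    by (auto intro: card_image_le)
  ultimately have "card (snd \<sigma> ` tvars_lits (lits D)) = card (tvars_lits (lits D))"
    "card (fst \<sigma> ` pvars_lits (lits D)) = card (pvars_lits (lits D))"
    using assms(2) tvars_subst[of \<sigma> D] pvars_subst[of \<sigma> D] by (auto simp: nvars_def)
  then have "inj_on (snd \<sigma>) (tvars_lits (lits D))" "inj_on (fst \<sigma>) (pvars_lits (lits D))"
    using finite_vars eq_card_imp_inj_on by blast+
  note inj = this
  obtain g where g: "bij g" "\<forall>x\<in>tvars_lits (lits D). g x = snd \<sigma> x"
    using bij_extend_nat[OF finite_vars(1) inj(1)] by blast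
  obtain h where h: "bij h" "\<forall>p. arity (h p) = arity p" "\<forall>p\<in>pvars_lits (lits D). h p = fst \<sigma> p"
    using bij_extend_pvar[OF finite_vars(2) inj(2) assms(1)[unfolded is_subst_def]] by blast
  have "subst_clause (h, g) D = C"
    using subst_clause_cong[of D "(h, g)" \<sigma>] g h assms(2) by auto
  then have "variant D C" using g h by (auto simp: variant_def is_renaming_def is_subst_def)
  then show False using assms(3) variant_sym by blast
qed

lemma most_general_covers:
  assumes "C \<in> S"
  shows "\<exists>D \<in> most_general S. \<exists>\<sigma>. is_subst \<sigma> \<and> subst_clause \<sigma> D = C"
proof -
  define P where "P D \<longleftrightarrow> D \<in> S \<and> (\<exists>\<sigma>. is_subst \<sigma> \<and> subst_clause \<sigma> D = C)" for D
  let ?w = "\<lambda>C. (\<Sum>A\<in>#lits C. length (args_of A)) + size (lits C)"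
  have P0: "P C" using assms subst_id[of C] unfolding P_def is_subst_def by (metis fst_conv id_apply)
  have tv: "card (tvars_lits M) \<le> (\<Sum>A\<in>#M. length (args_of A))" for M
  proof (induction M)
    case (add A M)
    have "card (tvars_lits (add_mset A M)) \<le> card (set (args_of A)) + card (tvars_lits M)"
      by (simp add: tvars_lits_def card_Un_le)
    also have "\<dots> \<le> length (args_of A) + card (tvars_lits M)" by (simp add: card_length)
    finally show ?case using add by simp
  qed (simp add: tvars_lits_def)
  have pv: "card (pvars_lits M) \<le> size M" for M
  proof (induction M)
    case (add A M)
    have "card (pvars_lits (add_mset A M)) \<le> Suc (card (pvars_lits M))"
      by (simp add: pvars_lits_def card_insert_le_m1 card_insert_if)
    then show ?case using add by simp
  qed (simp add: pvars_lits_def)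
  have w: "?w (subst_clause \<sigma> D) = ?w D" for \<sigma> D
    by (simp add: lits_subst subst_atom_def multiset.map_comp comp_def)
  have bnd: "nvars D \<le> ?w C" if "P D" for D
  proof -
    have "nvars D \<le> ?w D" unfolding nvars_def using tv pv by (rule add_mono)
    with that w show ?thesis unfolding P_def by metis
  qed
  obtain D where D: "P D" "\<And>E. P E \<Longrightarrow> nvars E \<le> nvars D"
    using ex_has_greatest_nat[of P C nvars "Suc (?w C)"] P0 bnd le_imp_less_Suc by blast
  have "variant D E" if "E \<in> S" "is_subst \<sigma>" "subst_clause \<sigma> E = D" for E \<sigma>
  proof (rule ccontr)
    assume "\<not> variant D E"
    then have "nvars D < nvars E" using nvars_less that by blast
    obtain \<tau> where "is_subst \<tau>" "subst_clause \<tau> D = C" using D(1) by (auto simp: P_def)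
    then have "is_subst (comp_subst \<tau> \<sigma>)" "subst_clause (comp_subst \<tau> \<sigma>) E = C"
      using that subst_comp[of \<tau> \<sigma> E] by (auto simp: is_subst_def comp_subst_def)
    then have "P E" using that unfolding P_def by blast
    then show False using D(2) \<open>nvars D < nvars E\<close> by fastforce
  qed
  then have "D \<in> most_general S" using D(1) unfolding most_general_def P_def by blast
  then show ?thesis using D(1) unfolding P_def by blast
qed

end

theory Submission
  imports Defs
begin

text \<open>Splitting off two body literals \<open>A, B\<close> and joining the two parts by a fresh literal that
  lists the variables shared by \<open>{A, B}\<close> and the remaining literals exhibits a clause as a
  resolvent of two smaller connected clauses, provided that at most \<open>a\<close> variables are shared.
  Most general clauses have pairwise distinct predicate variables, and a literal whose removal
  leaves the clause connected shares exactly one variable \<open>v\<close> with the rest: otherwise another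
  shared variable could be renamed apart in it. A connected clause has at least two such literals.
  If for one of them, \<open>A\<close>, the variable \<open>v\<close> occurs in another body literal \<open>B\<close>, then
  the shared variables all occur in \<open>B\<close>. Otherwise two such body literals \<open>A, B\<close> are
  attached to the head alone, and the shared variables all occur in the head.\<close>

section \<open>Connected multisets of literals\<close>

definition connected_lits :: "atom multiset \<Rightarrow> bool" where
  "connected_lits M \<longleftrightarrow>
     \<not> (\<exists>P Q. P \<noteq> {#} \<and> Q \<noteq> {#} \<and> M = P + Q \<and> tvars_lits P \<inter> tvars_lits Q = {})"

lemma connected_clause_iff: "connected_clause C \<longleftrightarrow> connected_lits (lits C)"
  unfolding connected_clause_def connected_lits_def ..

lemma tvars_lits_simps [simp]:
  "tvars_lits {#} = {}"
  "tvars_lits (add_mset A M) = set (args_of A) \<union> tvars_lits M"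
  "tvars_lits (M + N) = tvars_lits M \<union> tvars_lits N"
  by (auto simp: tvars_lits_def)

lemma pvars_lits_simps [simp]:
  "pvars_lits {#} = {}"
  "pvars_lits (add_mset A M) = insert (pred_of A) (pvars_lits M)"
  "pvars_lits (M + N) = pvars_lits M \<union> pvars_lits N"
  by (auto simp: pvars_lits_def)

lemma in_tvars_litsE:
  assumes "x \<in> tvars_lits M"
  obtains A N where "M = add_mset A N" "x \<in> set (args_of A)"
  using assms unfolding tvars_lits_def by (metis UN_E multi_member_split)

lemma pred_in_pvars_lits: "A \<in># M \<Longrightarrow> pred_of A \<in> pvars_lits M"
  by (auto simp: pvars_lits_def)

text \<open>Either half of a splitting may be called the first, so it suffices to test the
  splittings that put \<open>A\<close> on a fixed side.\<close>

lemma connected_lits_add_mset: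
  "connected_lits (add_mset A K) \<longleftrightarrow>
     (\<forall>P Q. K = P + Q \<longrightarrow> Q \<noteq> {#} \<longrightarrow> tvars_lits (add_mset A P) \<inter> tvars_lits Q \<noteq> {})"
    (is "?L \<longleftrightarrow> ?R")
proof
  assume L: ?L
  show ?R
  proof (intro allI impI)
    fix P Q assume "K = P + Q" "Q \<noteq> {#}"
    then have "add_mset A K = add_mset A P + Q" "add_mset A P \<noteq> {#}" by simp_all
    then show "tvars_lits (add_mset A P) \<inter> tvars_lits Q \<noteq> {}"
      using L \<open>Q \<noteq> {#}\<close> unfolding connected_lits_def by blast
  qed
next
  assume R: ?R
  have aux: "tvars_lits P \<inter> tvars_lits Q \<noteq> {}"
    if eq: "add_mset A K = P + Q" and ne: "Q \<noteq> {#}" and mem: "A \<in># P" for P Q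
  proof -
    obtain P0 where P0: "P = add_mset A P0" using mem by (metis multi_member_split)
    then have "K = P0 + Q" using eq by simp
    then show ?thesis using R ne P0 by blast
  qed
  show ?L unfolding connected_lits_def
  proof (intro notI, elim exE conjE)
    fix P Q assume *: "P \<noteq> {#}" "Q \<noteq> {#}" "add_mset A K = P + Q" "tvars_lits P \<inter> tvars_lits Q = {}"
    have "A \<in># P + Q" unfolding *(3)[symmetric] by simp
    then consider "A \<in># P" | "A \<in># Q" by auto
    then show False
    proof cases
      case 1
      then show False using aux[of P Q] * by blast
    next
      case 2
      have "add_mset A K = Q + P" using *(3) by (simp add: add.commute)
      then show False using 2 aux[of Q P] * by blast
    qed
  qed
qed

lemma connected_lits_extend:
  assumes "connected_lits K" and "set (args_of A) \<inter> tvars_lits K \<noteq> {}"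
  shows "connected_lits (add_mset A K)"
  unfolding connected_lits_add_mset
proof (intro allI impI)
  fix P Q assume K: "K = P + Q" "Q \<noteq> {#}"
  show "tvars_lits (add_mset A P) \<inter> tvars_lits Q \<noteq> {}"
  proof (cases "P = {#}")
    case True
    then show ?thesis using K assms(2) by simp
  next
    case False
    then have "tvars_lits P \<inter> tvars_lits Q \<noteq> {}"
      using K assms(1) unfolding connected_lits_def by blast
    then show ?thesis by auto
  qed
qed

text \<open>The one-sided criterion mentions \<open>A\<close> only through its set of
  variables.\<close>

lemma connected_lits_replace:
  assumes "connected_lits (add_mset A K)" and "set (args_of A') = set (args_of A)"
  shows "connected_lits (add_mset A' K)"
  using assms by (simp add: connected_lits_add_mset)

text \<open>A part \<open>Q\<close> of \<open>S\<close> cut off from \<open>L\<close> and the rest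
  of \<open>S\<close> would also be cut off from \<open>T\<close>, because every variable shared
  with \<open>T\<close> occurs in \<open>L\<close>; this would split \<open>S + T\<close>. Applied
  to either side, it makes both premises connected.\<close>

lemma connected_lits_interface:
  assumes "connected_lits (S + T)" "T \<noteq> {#}"
    and "tvars_lits S \<inter> tvars_lits T \<subseteq> set (args_of L)"
  shows "connected_lits (add_mset L S)"
  unfolding connected_lits_add_mset
proof (intro allI impI notI)
  fix P Q assume *: "S = P + Q" "Q \<noteq> {#}" "tvars_lits (add_mset L P) \<inter> tvars_lits Q = {}"
  then have "S + T = Q + (P + T)" "P + T \<noteq> {#}" using assms(2) by auto
  moreover have "tvars_lits Q \<inter> tvars_lits (P + T) = {}"
    using * assms(3) by auto
  ultimately show False using assms(1) *(2) unfolding connected_lits_def by blast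
qed

text \<open>A substitution can merge variables but not separate them, so a splitting of the image
  pulls back to one of \<open>M\<close>.\<close>

lemma connected_lits_subst:
  assumes "connected_lits M"
  shows "connected_lits (image_mset (subst_atom \<sigma>) M)"
  unfolding connected_lits_def
proof (intro notI, elim exE conjE)
  fix P Q assume *: "P \<noteq> {#}" "Q \<noteq> {#}" "image_mset (subst_atom \<sigma>) M = P + Q"
    "tvars_lits P \<inter> tvars_lits Q = {}"
  obtain P' Q' where M: "M = P' + Q'" "P = image_mset (subst_atom \<sigma>) P'"
    "Q = image_mset (subst_atom \<sigma>) Q'"
    using *(3) by (metis image_mset_eq_plusD)
  have tv: "tvars_lits (image_mset (subst_atom \<sigma>) N) = snd \<sigma> ` tvars_lits N" for N
    by (auto simp: tvars_lits_def subst_atom_def)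
  have "tvars_lits P' \<inter> tvars_lits Q' = {}" using *(4) unfolding M tv by blast
  moreover have "P' \<noteq> {#}" "Q' \<noteq> {#}" using *(1,2) M by auto
  ultimately show False using assms M(1) unfolding connected_lits_def by blast
qed

text \<open>The analogue of a non-cut vertex other than a given one. A maximal connected proper part
  \<open>K\<close> around \<open>H\<close> misses a single literal: by connectedness of
  \<open>M\<close> some literal outside touches \<open>K\<close>, and adding it to \<open>K\<close>
  preserves connectedness.\<close>

lemma connected_lits_non_cut:
  assumes conn: "connected_lits M" and H: "H \<in># M" and size: "2 \<le> size M"
  obtains A K where "M = add_mset A K" "H \<in># K" "connected_lits K"
proof -
  define P where "P K \<longleftrightarrow> K \<subset># M \<and> H \<in># K \<and> connected_lits K" for K
  have "{#H#} \<noteq> M" using size by auto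
  then have "P {#H#}"
    using H unfolding P_def by (simp add: subset_mset.less_le connected_lits_add_mset)
  moreover have "size K < size M" if "P K" for K
    using that by (simp add: P_def mset_subset_size)
  ultimately obtain K where K: "P K" and max: "\<And>K'. P K' \<Longrightarrow> size K' \<le> size K"
    using ex_has_greatest_nat[of P "{#H#}" size "size M"] by blast
  define N where "N = M - K"
  have M: "M = K + N" "N \<noteq> {#}" "K \<noteq> {#}"
    using K by (auto simp: P_def N_def subset_mset.less_le Diff_eq_empty_iff_mset)
  then obtain x where "x \<in> tvars_lits K" "x \<in> tvars_lits N"
    using conn unfolding connected_lits_def by blast
  then obtain A N' where A: "N = add_mset A N'" "x \<in> set (args_of A)"
    by (auto elim: in_tvars_litsE)
  have "connected_lits (add_mset A K)"
    using K A(2) \<open>x \<in> tvars_lits K\<close> by (intro connected_lits_extend) (auto simp: P_def)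
  then have "\<not> add_mset A K \<subset># M" using max[of "add_mset A K"] K by (auto simp: P_def)
  then have "add_mset A K = M" using M(1) A(1) by (auto simp: subset_mset.less_le)
  then show thesis using that K unfolding P_def by metis
qed

section \<open>Consequences of being most general\<close>

text \<open>\<open>D\<close> is itself an image of \<open>C\<close>, and images have no more
  variables. Used contrapositively: a clause of \<open>S\<close> with an extra variable and instance
  \<open>C\<close> yields a contradiction.\<close>

lemma most_general_nvars:
  assumes "C \<in> most_general S" "D \<in> S" "is_subst \<sigma>" "subst_clause \<sigma> D = C"
  shows "nvars D \<le> nvars C"
proof -
  obtain \<rho> where "subst_clause \<rho> C = D"
    using assms unfolding most_general_def variant_def by blast
  then have "tvars_lits (lits D) = snd \<rho> ` tvars_lits (lits C)"
    "pvars_lits (lits D) = fst \<rho> ` pvars_lits (lits C)"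
    using tvars_subst pvars_subst by blast+
  then show ?thesis unfolding nvars_def by (simp add: add_mono card_image_le finite_vars)
qed

text \<open>Allows one literal to be modified without distinguishing whether it is the head or in
  the body.\<close>

lemma replace_literal:
  assumes "lits C = add_mset A K"
  obtains C' where "lits C' = add_mset A' K"
    "\<And>\<sigma>. subst_atom \<sigma> A' = A \<Longrightarrow> (\<And>B. B \<in># K \<Longrightarrow> subst_atom \<sigma> B = B) \<Longrightarrow> subst_clause \<sigma> C' = C"
proof (cases "head C = Some A")
  case True
  then have "body C = K" using assms by (simp add: lits_def)
  with True show thesis
    by (intro that[of "Clause (Some A') K"])
      (auto simp: lits_def subst_clause_def intro!: clause.expand multiset.map_ident_strong)
next
  case False
  then have "A \<in># body C"
    using assms by (auto simp: lits_def split: option.splits) (metis insert_noteq_member)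
  then obtain B where B: "body C = add_mset A B" by (metis multi_member_split)
  then have K: "K = (case head C of None \<Rightarrow> {#} | Some H \<Rightarrow> {#H#}) + B"
    using assms by (auto simp: lits_def)
  show thesis
  proof (rule that[of "Clause (head C) (add_mset A' B)"])
    show "lits (Clause (head C) (add_mset A' B)) = add_mset A' K"
      by (simp add: lits_def K)
    show "subst_clause \<sigma> (Clause (head C) (add_mset A' B)) = C"
      if "subst_atom \<sigma> A' = A" "\<And>B. B \<in># K \<Longrightarrow> subst_atom \<sigma> B = B" for \<sigma>
      using that B K by (cases C; cases "head C")
        (auto simp: subst_clause_def intro!: multiset.map_ident_strong)
  qed
qed

lemma subst_atom_idI:
  assumes "fst \<sigma> (pred_of A) = pred_of A" "\<And>x. x \<in> set (args_of A) \<Longrightarrow> snd \<sigma> x = x"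
  shows "subst_atom \<sigma> A = A"
  using assms by (cases A) (auto simp: subst_atom_def intro: map_idI)

abbreviation all_Hc :: "nat \<Rightarrow> clause set" where
  "all_Hc a \<equiv> bounded_clauses {C. wf_clause C \<and> connected_clause C} (enat a) \<infinity>"

lemma in_bounded_iff:
  "C \<in> bounded_clauses {C. wf_clause C \<and> connected_clause C} (enat a) b \<longleftrightarrow>
     connected_lits (lits C) \<and> (\<forall>A\<in>#lits C. wf_atom A \<and> arity (pred_of A) \<le> a) \<and>
     enat (body_size C) \<le> b"
  by (auto simp: bounded_clauses_def wf_clause_def connected_clause_iff)

text \<open>Replacing a repeated predicate variable in \<open>A\<close> alone by a fresh one gives a
  clause with instance \<open>C\<close> and one more predicate variable. Connectedness is
  unaffected, as it depends on term variables only.\<close>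

lemma most_general_distinct_preds:
  assumes C: "C \<in> most_general (all_Hc a)" and lits: "lits C = add_mset A K"
  shows "pred_of A \<notin> pvars_lits K"
proof
  assume dup: "pred_of A \<in> pvars_lits K"
  have inS: "C \<in> all_Hc a" using C by (simp add: most_general_def)
  \<comment> \<open>A fresh name makes \<open>p\<close> fresh whatever its arity.\<close>
  have "finite (pname ` pvars_lits (lits C))" by (simp add: finite_vars)
  then obtain f where f: "f \<notin> pname ` pvars_lits (lits C)" using ex_new_if_finite[OF infinite_UNIV_nat] by blast
  define p where "p = PVar f (arity (pred_of A))"
  have p: "p \<notin> pvars_lits (lits C)" using f by (force simp: p_def)
  define A' where "A' = Atom p (args_of A)"
  obtain C' where C': "lits C' = add_mset A' K"
    "\<And>\<sigma>. subst_atom \<sigma> A' = A \<Longrightarrow> (\<And>B. B \<in># K \<Longrightarrow> subst_atom \<sigma> B = B) \<Longrightarrow> subst_clause \<sigma> C' = C"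
    using replace_literal[OF lits] by blast
  let ?\<sigma> = "(id(p := pred_of A), id) :: subst"
  have "subst_clause ?\<sigma> C' = C"
  proof (rule C'(2))
    show "subst_atom ?\<sigma> A' = A" by (simp add: A'_def subst_atom_def)
    show "subst_atom ?\<sigma> B = B" if "B \<in># K" for B
      using that p lits by (intro subst_atom_idI) (auto simp: pvars_lits_def)
  qed
  moreover have "is_subst ?\<sigma>" by (simp add: is_subst_def p_def)
  moreover have "C' \<in> all_Hc a"
    using inS connected_lits_replace[of A K A'] lits
    by (auto simp: in_bounded_iff C'(1) A'_def wf_atom_def p_def)
  ultimately have "nvars C' \<le> nvars C" using most_general_nvars[OF C] by blast
  moreover have "pvars_lits (lits C') = insert p (pvars_lits (lits C))"
    using dup lits C'(1) by (auto simp: A'_def)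
  moreover have "tvars_lits (lits C') = tvars_lits (lits C)"
    using lits C'(1) by (auto simp: A'_def)
  ultimately show False using p by (simp add: nvars_def finite_vars)
qed

text \<open>Connectedness gives one shared variable \<open>v\<close>. Were there another one
  \<open>w\<close>, renaming \<open>w\<close> to a fresh \<open>u\<close> in \<open>A\<close> only
  would keep the link through \<open>v\<close> to the connected rest, and the result would be
  strictly more general.\<close>

lemma most_general_non_cut_shares_one:
  assumes C: "C \<in> most_general (all_Hc a)" and lits: "lits C = add_mset A K"
    and K: "connected_lits K" "K \<noteq> {#}"
  obtains v where "set (args_of A) \<inter> tvars_lits K = {v}"
proof -
  have inS: "C \<in> all_Hc a" using C by (simp add: most_general_def)
  then have "connected_lits (add_mset A K)" using lits by (simp add: in_bounded_iff)
  then obtain v where v: "v \<in> set (args_of A)" "v \<in> tvars_lits K"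
    using K(2) unfolding connected_lits_add_mset by (metis add_0 disjoint_iff sup_bot.right_neutral tvars_lits_simps(1,2))
  have "w = v" if w: "w \<in> set (args_of A)" "w \<in> tvars_lits K" for w
  proof (rule ccontr)
    assume "w \<noteq> v"
    obtain u where u: "u \<notin> tvars_lits (lits C)"
      using finite_vars(1) ex_new_if_finite[OF infinite_UNIV_nat] by blast
    define A' where "A' = Atom (pred_of A) (map (id(w := u)) (args_of A))"
    obtain C' where C': "lits C' = add_mset A' K"
      "\<And>\<sigma>. subst_atom \<sigma> A' = A \<Longrightarrow> (\<And>B. B \<in># K \<Longrightarrow> subst_atom \<sigma> B = B) \<Longrightarrow> subst_clause \<sigma> C' = C"
      using replace_literal[OF lits] by blast
    let ?\<sigma> = "(id, id(u := w)) :: subst"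
    have "subst_clause ?\<sigma> C' = C"
    proof (rule C'(2))
      have "map (\<lambda>x. (id(u := w)) ((id(w := u)) x)) (args_of A) = args_of A"
        using u lits by (intro map_idI) auto
      then show "subst_atom ?\<sigma> A' = A" by (simp add: A'_def subst_atom_def comp_def)
      show "subst_atom ?\<sigma> B = B" if "B \<in># K" for B
        using that u lits by (intro subst_atom_idI) (auto simp: tvars_lits_def)
    qed
    moreover have "is_subst ?\<sigma>" by (simp add: is_subst_def)
    moreover have "v \<in> set (args_of A')" using v \<open>w \<noteq> v\<close> by (force simp: A'_def)
    then have "connected_lits (add_mset A' K)" using K(1) v by (intro connected_lits_extend) auto
    then have "C' \<in> all_Hc a"
      using inS lits by (auto simp: in_bounded_iff C'(1) A'_def wf_atom_def)
    ultimately have "nvars C' \<le> nvars C" using most_general_nvars[OF C] by blast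
    moreover have "pvars_lits (lits C') = pvars_lits (lits C)"
      using lits C'(1) by (auto simp: A'_def)
    \<comment> \<open>\<open>w\<close> survives in \<open>K\<close>, so \<open>u\<close> is gained
      and nothing is lost.\<close>
    moreover have "tvars_lits (lits C') = insert u (tvars_lits (lits C))"
      using w lits C'(1) by (auto simp: A'_def)
    ultimately show False using u by (simp add: nvars_def finite_vars)
  qed
  then have "set (args_of A) \<inter> tvars_lits K = {v}" using v by blast
  then show thesis by (rule that)
qed

section \<open>Resolving the two parts of a split clause\<close>

text \<open>The variables \<open>xs\<close> of the interface are shifted by \<open>N\<close> in the second premise only;
  its other variables do not occur in the first premise, so the resolvent is \<open>C\<close> itself.\<close>

lemma sld_resolvent_split:
  assumes C: "C = Clause h (S + T)"
    and T': "T' = lits (Clause h T)"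
    and xs: "set xs = tvars_lits S \<inter> tvars_lits T'"
    and disj: "pvars_lits S \<inter> pvars_lits T' = {}"
  obtains p q \<rho> where "arity p = length xs" "arity q = length xs" "is_subst \<rho>" "fst \<rho> = id"
    "sld_resolvent (Clause h (add_mset (Atom p xs) T))
       (subst_clause \<rho> (Clause (Some (Atom q xs)) S)) C"
proof -
  have litsC: "lits C = S + T'" by (simp add: C T' lits_def)
  obtain N where N: "\<And>x. x \<in> tvars_lits (lits C) \<Longrightarrow> x < N"
    using finite_vars(1)[of C] by (metis finite_nat_set_iff_bounded)
  have "finite (pname ` pvars_lits (lits C))" by (simp add: finite_vars)
  then obtain f where f: "\<And>x. x \<in> pvars_lits (lits C) \<Longrightarrow> pname x < f"
    by (metis finite_nat_set_iff_bounded imageI)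
  define p where "p = PVar f (length xs)"
  define q where "q = PVar (Suc f) (length xs)"
  have pq: "p \<notin> pvars_lits (lits C)" "q \<notin> pvars_lits (lits C)" "p \<noteq> q" "arity p = arity q"
    using f by (fastforce simp: p_def q_def)+
  define g where "g x = (if x \<in> set xs then x + N else x)" for x
  define \<rho> :: subst where "\<rho> = (id, g)"
  \<comment> \<open>Undoes the shift and identifies \<open>q\<close> with \<open>p\<close>. It fixes
    the literals of \<open>C\<close>, whose variables lie below \<open>N\<close> and whose
    predicates differ from \<open>q\<close>.\<close>
  define \<theta> :: subst where
    "\<theta> = (id(q := p), \<lambda>z. if \<exists>x\<in>set xs. z = x + N then z - N else z)"
  let ?L = "Atom p xs" and ?H = "Atom q (map g xs)"
  have xsN: "x < N" if "x \<in> set xs" for x using that xs N litsC by auto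
  have \<theta>_small: "snd \<theta> z = z" if "z < N" for z using that by (auto simp: \<theta>_def)
  have \<theta>_g: "snd \<theta> (g x) = x" if "x < N" for x using that by (auto simp: \<theta>_def g_def)
  have fix1: "subst_atom \<theta> A = A" if "A \<in># lits C" for A
  proof (rule subst_atom_idI)
    show "fst \<theta> (pred_of A) = pred_of A"
      using pq pred_in_pvars_lits[OF that] by (auto simp: \<theta>_def)
    show "snd \<theta> x = x" if "x \<in> set (args_of A)" for x
      using that \<open>A \<in># lits C\<close> N \<theta>_small by (auto simp: tvars_lits_def)
  qed
  have fix2: "subst_atom \<theta> (subst_atom \<rho> A) = A" if "A \<in># lits C" for A
  proof -
    have "map (\<lambda>x. snd \<theta> (g x)) (args_of A) = args_of A"
      using that N \<theta>_g by (intro map_idI) (auto simp: tvars_lits_def)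
    moreover have "fst \<theta> (pred_of A) = pred_of A"
      using pq pred_in_pvars_lits[OF that] by (auto simp: \<theta>_def)
    ultimately show ?thesis by (cases A) (simp add: subst_atom_def \<rho>_def comp_def)
  qed
  have "is_mgu \<theta> ?L ?H"
    unfolding is_mgu_def
  proof (intro conjI allI impI)
    have "map (snd \<theta>) (map g xs) = xs" "map (snd \<theta>) xs = xs"
      using xsN \<theta>_g \<theta>_small by (auto intro!: map_idI)
    then have "subst_atom \<theta> ?H = Atom (fst \<theta> q) xs" "subst_atom \<theta> ?L = Atom (fst \<theta> p) xs"
      unfolding subst_atom_def by (simp_all del: map_map)
    then show "is_unifier \<theta> ?L ?H"
      using pq by (auto simp: is_unifier_def is_subst_def \<theta>_def)
    fix \<tau> assume "is_unifier \<tau> ?L ?H"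
    then have \<tau>: "is_subst \<tau>" "fst \<tau> p = fst \<tau> q" "\<And>x. x \<in> set xs \<Longrightarrow> snd \<tau> x = snd \<tau> (x + N)"
      by (auto simp: is_unifier_def subst_atom_def g_def)
    \<comment> \<open>The unifier is its own factor: \<open>\<theta>\<close> only sends
      \<open>q\<close> to \<open>p\<close> and \<open>x + N\<close> to \<open>x\<close>, and
      \<open>\<tau>\<close> already agrees on these pairs.\<close>
    have "\<tau> = comp_subst \<tau> \<theta>"
      using \<tau> by (intro prod_eqI ext) (auto simp: comp_subst_def \<theta>_def)
    then show "\<exists>\<delta>. is_subst \<delta> \<and> \<tau> = comp_subst \<delta> \<theta>" using \<tau>(1) by blast
  qed
  moreover have "C = subst_clause \<theta> (Clause h (T + image_mset (subst_atom \<rho>) S))"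
  proof -
    have "image_mset (subst_atom \<theta>) T = T"
      using fix1 by (intro multiset.map_ident_strong) (auto simp: C lits_def)
    moreover have "image_mset (subst_atom \<theta> \<circ> subst_atom \<rho>) S = S"
      using fix2 by (intro multiset.map_ident_strong) (auto simp: litsC)
    moreover have "map_option (subst_atom \<theta>) h = h"
      using fix1 by (cases h) (auto simp: C lits_def)
    ultimately show ?thesis
      by (simp add: C subst_clause_def multiset.map_comp add.commute)
  qed
  moreover have D: "subst_clause \<rho> (Clause (Some (Atom q xs)) S) =
      Clause (Some ?H) (image_mset (subst_atom \<rho>) S)"
    by (simp add: subst_clause_def subst_atom_def \<rho>_def)
  ultimately have "resolve_body_head (Clause h (add_mset ?L T))
      (subst_clause \<rho> (Clause (Some (Atom q xs)) S)) C"
    unfolding resolve_body_head_def by (intro exI[of _ ?L] exI[of _ ?H] exI[of _ \<theta>]) simp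
  moreover have "variable_disjoint (Clause h (add_mset ?L T))
      (subst_clause \<rho> (Clause (Some (Atom q xs)) S))"
  proof -
    have l1: "lits (Clause h (add_mset ?L T)) = add_mset ?L T'" by (simp add: T' lits_def)
    have l2: "lits (Clause (Some (Atom q xs)) S) = add_mset (Atom q xs) S" by (simp add: lits_def)
    \<comment> \<open>A shared \<open>y\<close> is shifted beyond all variables of \<open>C\<close>;
      an unshared one does not occur in \<open>T'\<close>.\<close>
    have "x \<noteq> g y" if "x \<in> tvars_lits T'" "y \<in> tvars_lits S" for x y
      using that N[of x] xs by (auto simp: g_def litsC)
    then show ?thesis
      unfolding variable_disjoint_def tvars_subst pvars_subst l1 l2
      using disj pq xs by (fastforce simp: \<rho>_def litsC)
  qed
  ultimately show thesis
    by (intro that[of p q \<rho>]) (auto simp: sld_resolvent_def p_def q_def \<rho>_def is_subst_def)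
qed

text \<open>The interface literal replaces the at least two literals of \<open>S\<close> in one
  premise, and the other premise lacks the non-empty \<open>T\<close>, so both bodies shrink. The
  arity of the interface is positive by connectedness and at most \<open>a\<close> by
  \<open>shared\<close>.\<close>

lemma sld_inference_split:
  assumes C: "C \<in> most_general (all_Hc a)"
    and body: "body C = S + T" and size: "2 \<le> size S" "S \<noteq> body C"
    and T': "T' = lits (Clause (head C) T)" "T' \<noteq> {#}"
    and shared: "card (tvars_lits S \<inter> tvars_lits T') \<le> a"
    and n: "n = body_size C - 1"
  obtains C\<^sub>1 C\<^sub>2 where "C\<^sub>1 \<in> Hc (enat a) (enat n)" "C\<^sub>2 \<in> Hc (enat a) (enat n)"
    "sld_inference C\<^sub>1 C\<^sub>2 C"
proof -
  have inS: "C \<in> all_Hc a" using C by (simp add: most_general_def)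
  have litsC: "lits C = S + T'" by (simp add: body T'(1) lits_def)
  have conn: "connected_lits (S + T')" using inS litsC by (simp add: in_bounded_iff)
  have bounds: "\<forall>A\<in>#S + T'. wf_atom A \<and> arity (pred_of A) \<le> a"
    using inS unfolding in_bounded_iff litsC by blast
  have S_ne: "S \<noteq> {#}" using size by auto
  define W where "W = tvars_lits S \<inter> tvars_lits T'"
  have "finite W" by (auto simp: W_def tvars_lits_def)
  then obtain xs where xs: "set xs = W" "distinct xs" using finite_distinct_list by blast
  have len: "1 \<le> length xs" "length xs \<le> a"
  proof -
    have "W \<noteq> {}" using conn S_ne T'(2) unfolding connected_lits_def W_def by blast
    then show "1 \<le> length xs" using xs by (cases xs) auto
    show "length xs \<le> a" using shared xs distinct_card[of xs] by (simp add: W_def)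
  qed
  \<comment> \<open>Only term variables are renamed between the premises, so their predicate
    variables must be disjoint from the outset.\<close>
  have "pvars_lits S \<inter> pvars_lits T' = {}"
  proof (rule ccontr)
    assume "pvars_lits S \<inter> pvars_lits T' \<noteq> {}"
    then obtain A where A: "A \<in># S" "pred_of A \<in> pvars_lits T'" by (auto simp: pvars_lits_def)
    then obtain S0 where "S = add_mset A S0" by (metis multi_member_split)
    then have "lits C = add_mset A (S0 + T')" using litsC by simp
    then show False using most_general_distinct_preds[OF C] A(2) by fastforce
  qed
  moreover have "C = Clause (head C) (S + T)" using body by (cases C) simp
  ultimately obtain p q \<rho> where pq: "arity p = length xs" "arity q = length xs"
    and \<rho>: "is_subst \<rho>" "fst \<rho> = id"
    and res: "sld_resolvent (Clause (head C) (add_mset (Atom p xs) T))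
       (subst_clause \<rho> (Clause (Some (Atom q xs)) S)) C" (is "sld_resolvent ?D ?E C")
    using sld_resolvent_split[OF _ T'(1), of C S xs] xs(1) unfolding W_def by blast
  have sz: "body_size C = size S + size T" by (simp add: body_size_def body)
  have "T \<noteq> {#}" using size(2) body by auto
  then have T_pos: "1 \<le> size T" by (simp add: Suc_le_eq nonempty_has_size)
  have "lits ?D = add_mset (Atom p xs) T'" by (simp add: lits_def T'(1))
  moreover have "connected_lits (add_mset (Atom p xs) T')"
    using connected_lits_interface[of T' S "Atom p xs"] conn S_ne xs
    by (auto simp: W_def add.commute)
  moreover have "body_size ?D \<le> n" using size(1) sz n by (simp add: body_size_def)
  ultimately have D: "?D \<in> bounded_clauses {C. wf_clause C \<and> connected_clause C} (enat a) (enat n)"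
    using bounds pq len by (auto simp: in_bounded_iff wf_atom_def)
  have "lits ?E = image_mset (subst_atom \<rho>) (add_mset (Atom q xs) S)"
    by (simp add: lits_subst) (simp add: lits_def)
  moreover have "connected_lits (add_mset (Atom q xs) S)"
    using connected_lits_interface[of S T' "Atom q xs"] conn T'(2) xs by (auto simp: W_def)
  moreover have "body_size ?E \<le> n" using T_pos sz n unfolding body_size_subst by (simp add: body_size_def)
  ultimately have E: "?E \<in> bounded_clauses {C. wf_clause C \<and> connected_clause C} (enat a) (enat n)"
    using bounds pq len \<rho> connected_lits_subst[of "add_mset (Atom q xs) S" \<rho>]
    by (auto simp: in_bounded_iff wf_atom_def subst_atom_def)
  \<comment> \<open>The premises found need not be most general; they are instances of members of
    the fragment, which \<open>sld_inference\<close> permits.\<close>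
  obtain C\<^sub>1 \<sigma>\<^sub>1 where C1: "C\<^sub>1 \<in> Hc (enat a) (enat n)" "is_subst \<sigma>\<^sub>1" "subst_clause \<sigma>\<^sub>1 C\<^sub>1 = ?D"
    using most_general_covers[OF D] unfolding Hc_def by blast
  obtain C\<^sub>2 \<sigma>\<^sub>2 where C2: "C\<^sub>2 \<in> Hc (enat a) (enat n)" "is_subst \<sigma>\<^sub>2" "subst_clause \<sigma>\<^sub>2 C\<^sub>2 = ?E"
    using most_general_covers[OF E] unfolding Hc_def by blast
  have "variant C C"
    using subst_id[of C] unfolding variant_def is_renaming_def is_subst_def
    by (intro exI[of _ "(id, id)"]) auto
  then have "sld_inference C\<^sub>1 C\<^sub>2 C"
    unfolding sld_inference_def using C1 C2 res by metis
  then show thesis using that C1(1) C2(1) by blast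
qed

section \<open>Choosing the two body literals\<close>

lemma card_shared_le_arity:
  assumes "X \<subseteq> set (args_of B)" "wf_atom B" "arity (pred_of B) \<le> a"
  shows "card X \<le> a"
proof -
  have "card X \<le> card (set (args_of B))" using assms(1) by (simp add: card_mono)
  also have "\<dots> \<le> length (args_of B)" by (rule card_length)
  finally show ?thesis using assms(2,3) by (simp add: wf_atom_def)
qed

text \<open>Supplies the part \<open>S = {#A, B#}\<close> to split off. The bound always comes from
  a single literal of \<open>C\<close> that contains all shared variables.\<close>

lemma most_general_pair:
  assumes C: "C \<in> most_general (all_Hc a)" and size: "3 \<le> body_size C"
  obtains A B T where "body C = {#A, B#} + T"
    "card (tvars_lits {#A, B#} \<inter> tvars_lits (lits (Clause (head C) T))) \<le> a"
proof -
  note result = that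
  let ?h = "case head C of None \<Rightarrow> {#} | Some H \<Rightarrow> {#H#}"
  have inS: "C \<in> all_Hc a" using C by (simp add: most_general_def)
  have conn: "connected_lits (lits C)"
    and bounds: "\<And>A. A \<in># lits C \<Longrightarrow> wf_atom A \<and> arity (pred_of A) \<le> a"
    using inS unfolding in_bounded_iff by blast+
  have litsC: "lits C = ?h + body C" by (simp add: lits_def)
  have lits_T: "lits (Clause (head C) T) = ?h + T" for T by (simp add: lits_def)
  have size_lits: "2 \<le> size (lits C)" using size by (simp add: litsC body_size_def)
  \<comment> \<open>The easy case: \<open>A\<close> meets the rest in \<open>v\<close> at most, and
    \<open>v\<close> occurs in another body literal \<open>B\<close>, which then contains all shared
    variables.\<close>
  have pair: thesis
    if A: "body C = add_mset A K" "set (args_of A) \<inter> tvars_lits (?h + K) \<subseteq> {v}" "v \<in> tvars_lits K"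
    for A K v
  proof -
    obtain B T where B: "K = add_mset B T" "v \<in> set (args_of B)"
      using A(3) by (rule in_tvars_litsE)
    have "B \<in># lits C" using A(1) B(1) litsC by simp
    have "tvars_lits {#A, B#} \<inter> tvars_lits (?h + T) \<subseteq> set (args_of B)"
      using A(2) B by auto
    then have "card (tvars_lits {#A, B#} \<inter> tvars_lits (?h + T)) \<le> a"
      using bounds[OF \<open>B \<in># lits C\<close>] card_shared_le_arity by blast
    then show thesis using result[of A B T] A(1) B(1) lits_T by simp
  qed
  show thesis
  proof (cases "head C")
    case None
    then have l: "lits C = body C" by (simp add: litsC)
    \<comment> \<open>\<open>H\<close> is arbitrary and only keeps \<open>K\<close> non-empty;
      without a head, all of \<open>K\<close> lies in the body.\<close>
    obtain H where "H \<in># lits C" using size_lits by fastforce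
    then obtain A K where A: "lits C = add_mset A K" "H \<in># K" "connected_lits K"
      using connected_lits_non_cut[OF conn _ size_lits] by blast
    then obtain v where "set (args_of A) \<inter> tvars_lits K = {v}"
      using most_general_non_cut_shares_one[OF C] by (metis empty_iff set_mset_empty)
    then show thesis using pair[of A K v] A(1) l None by auto
  next
    case (Some H)
    have l: "lits C = add_mset H (body C)" by (simp add: litsC Some)
    \<comment> \<open>Retaining the head in \<open>K\<close> forces \<open>A\<close> to be a body
      literal.\<close>
    obtain A K where A: "lits C = add_mset A K" "H \<in># K" "connected_lits K"
      using connected_lits_non_cut[OF conn _ size_lits, of H] l by auto
    obtain v where v: "set (args_of A) \<inter> tvars_lits K = {v}"
      using most_general_non_cut_shares_one[OF C A(1,3)] A(2) by (metis empty_iff set_mset_empty)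
    obtain K0 where K0: "K = add_mset H K0" using A(2) by (metis multi_member_split)
    then have bodyA: "body C = add_mset A K0" using A(1) l by simp
    show thesis
    proof (cases "v \<in> tvars_lits K0")
      case True
      then show thesis using pair[OF bodyA, of v] v K0 Some by auto
    next
      case False
      then have vH: "v \<in> set (args_of H)" using v K0 by auto
      \<comment> \<open>A second removable literal, obtained by retaining \<open>A\<close> this
        time.\<close>
      obtain B K' where B: "lits C = add_mset B K'" "A \<in># K'" "connected_lits K'"
        using connected_lits_non_cut[OF conn _ size_lits, of A] A(1) by auto
      obtain w where w: "set (args_of B) \<inter> tvars_lits K' = {w}"
        using most_general_non_cut_shares_one[OF C B(1,3)] B(2) by (metis empty_iff set_mset_empty)
      have "K0 \<noteq> {#}" using size bodyA by (auto simp: body_size_def)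
      \<comment> \<open>\<open>K'\<close> still contains \<open>A\<close>, and predicate variables
        do not repeat.\<close>
      have "B \<noteq> A" using most_general_distinct_preds[OF C B(1)] pred_in_pvars_lits[OF B(2)] by auto
      \<comment> \<open>Otherwise \<open>v\<close> would be the only variable that \<open>A\<close>
        and \<open>H\<close> share with the other literals or each other. As \<open>v\<close> is
        absent from \<open>K0\<close>, the pair would be cut off from \<open>K0\<close>.\<close>
      have "B \<noteq> H"
      proof
        assume "B = H"
        then have K': "K' = add_mset A K0" using B(1) l bodyA by simp
        have "w = v" using w vH v \<open>B = H\<close> K' by auto
        then have "tvars_lits {#A, H#} \<inter> tvars_lits K0 = {}"
          using False v w K0 K' \<open>B = H\<close> by auto
        moreover have "lits C = {#A, H#} + K0" using A(1) K0 by simp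
        ultimately show False
          using conn \<open>K0 \<noteq> {#}\<close> unfolding connected_lits_def by (metis add_mset_not_empty)
      qed
      have "B \<in># add_mset A (add_mset H K0)" using B(1) A(1) K0 by (metis union_single_eq_member)
      then have "B \<in># K0" using \<open>B \<noteq> A\<close> \<open>B \<noteq> H\<close> by simp
      then obtain T where T: "K0 = add_mset B T" by (metis multi_member_split)
      have K': "K' = add_mset A (add_mset H T)"
        using B(1) A(1) K0 T by (simp add: add_mset_commute)
      show thesis
      proof (cases "w \<in> tvars_lits (add_mset A T)")
        case True
        show thesis
          using pair[of B "add_mset A T" w] bodyA T w K' Some True by (auto simp: add_mset_commute)
      next
        case w_notin: False
        have "w \<in> set (args_of H)" using w w_notin K' by auto
        \<comment> \<open>Now \<open>A\<close> and \<open>B\<close> both hang on the head alone,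
          through \<open>v\<close> and \<open>w\<close>, which may coincide.\<close>
        have sub: "tvars_lits {#A, B#} \<inter> tvars_lits (?h + T) \<subseteq> {v, w}"
          using v w K0 T K' Some by auto
        have "H \<in># lits C" using l by simp
        have "tvars_lits {#A, B#} \<inter> tvars_lits (?h + T) \<subseteq> set (args_of H)"
          using sub vH \<open>w \<in> set (args_of H)\<close> by auto
        then have "card (tvars_lits {#A, B#} \<inter> tvars_lits (?h + T)) \<le> a"
          using bounds[OF \<open>H \<in># lits C\<close>] card_shared_le_arity by blast
        then show thesis using result[of A B T] bodyA T lits_T by simp
      qed
    qed
  qed
qed

theorem mainTheorem4:
  fixes a :: nat
  assumes "1 \<le> a"
  shows "reducible_to (Hc (enat a) \<infinity>) 2"
  unfolding reducible_to_def bounded_Hc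
proof (intro ballI impI)
  fix C assume "C \<in> Hc (enat a) \<infinity>" and size: "2 < body_size C"
  then have C: "C \<in> most_general (all_Hc a)" by (simp add: Hc_def)
  obtain A B T where AB: "body C = {#A, B#} + T"
    "card (tvars_lits {#A, B#} \<inter> tvars_lits (lits (Clause (head C) T))) \<le> a"
    using most_general_pair[OF C] size by (metis Suc_le_eq eval_nat_numeral(3))
  have "T \<noteq> {#}" using size AB(1) by (auto simp: body_size_def)
  then have "lits (Clause (head C) T) \<noteq> {#}" "{#A, B#} \<noteq> body C"
    using AB(1) by (auto simp: lits_def)
  \<comment> \<open>The bound \<open>b'\<close> is \<open>body_size C - 1\<close>: one premise has
    \<open>T\<close> and the interface literal as body, the other just \<open>A\<close> and
    \<open>B\<close>.\<close>
  then obtain C\<^sub>1 C\<^sub>2 where "C\<^sub>1 \<in> Hc (enat a) (enat (body_size C - 1))"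
    "C\<^sub>2 \<in> Hc (enat a) (enat (body_size C - 1))" "sld_inference C\<^sub>1 C\<^sub>2 C"
    using sld_inference_split[OF C AB(1) _ _ refl _ AB(2) refl] by auto
  moreover have "body_size C - 1 < body_size C" using size by simp
  ultimately show "\<exists>b'<body_size C. \<exists>C\<^sub>1\<in>Hc (enat a) (enat b'). \<exists>C\<^sub>2\<in>Hc (enat a) (enat b').
      sld_inference C\<^sub>1 C\<^sub>2 C" by blast
qed

end
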